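(* Let $\mathbf A$ be a balanced residuated partially ordered semigroup with carrier $A$, and let $I\subseteq\operatorname{Sk}(\mathbf A)$ be a nonempty visible subsemilattice over which $\mathbf A$ is subsemilattice-steady. Then the visibility partition $\mathcal P_I$ is $\tau$-residuation-coherent. Consequently $\mathcal C_{\mathrm r}(\mathbf A)\le\mathcal P_I$, where $\le$ denotes refinement of partitions. Equivalently, every component $\{x\in A:\tau(x)\in C\}$ with $C\in\mathcal C_{\mathrm r}(\mathbf A)$ is contained in some visibility fibre $A^I_p=\{a\in A:u_a=p\}$, $p\in I$. In particular, if $\operatorname{Sk}(\mathbf A)$ is finite, then $|\mathcal C_{\mathrm r}(\mathbf A)|\ge|\mathcal P_I|=|I|$.
   Context: A residuated partially ordered semigroup is a structure $\mathbf A=\langle A,\le,\cdot,\backslash,/\rangle$ with $\langle A,\le\rangle$ a poset, $\langle A,\cdot\rangle$ a semigroup, and $xy\le z\iff x\le z/y\iff y\le x\backslash z$. An element $p\in A$ is positive if $z\le zp$ and $z\le pz$ for all $z\in A$. $\mathbf A$ is balanced if for every $x\in A$ one has $x\backslash x=x/x$ and this common value is positive; it is then automatically idempotent. Put $\tau(x):=x\backslash x=x/x$. The positive-idempotent skeleton $S=\operatorname{Sk}(\mathbf A)$ is the set of positive idempotents with the order inherited from $\mathbf A$; it is a join-semilattice in which $u\vee v=uv=vu$. For $P\subseteq S$ put $L_P:=\{x\in A:\tau(x)\in P\}$. A skeleton partition is a partition of $S$; $\Theta\le\Phi$ (refinement) iff every block of $\Theta$ is contained in a block of $\Phi$. For $P,Q\subseteq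 S$ put $P\star_\tau Q:=\{\tau(xy),\tau(x\backslash y),\tau(x/y): x\in L_P,\ y\in L_Q\}$. For a skeleton partition $\Theta$ and $P,Q\in\Theta$ put $\operatorname{Out}_\Theta(P,Q):=\{C\in\Theta: C\cap(P\star_\tau Q)\neq\varnothing\}$; $\Theta$ is $\tau$-residuation-coherent if all sets $\operatorname{Out}_\Theta(P,Q)$ are singletons. For a skeleton partition $\Theta$, form the graph on the blocks of $\Theta$ joining distinct blocks $C,D$ whenever there are $P,Q\in\Theta$ with $C,D\in\operatorname{Out}_\Theta(P,Q)$; $\operatorname{CC}_{\mathrm r}(\Theta)$ is the partition obtained by merging precisely the blocks lying in the same connected component. Let $\Theta_0=\{\{u\}:u\in S\}$, $\Theta_{n+1}=\operatorname{CC}_{\mathrm r}(\Theta_n)$, let $\equiv_n$ be the equivalence relation of $\Theta_n$, and let the residual coherentization $\mathcal C_{\mathrm r}(\mathbf A)$ be the partition of $S$ into the classes of $\bigcup_{n<\omega}\equiv_n$. A nonempty subsemilattice $I\subseteq\operatorname{Sk}(\mathbf A)$ (closed under products, i.e. joins) is visible if for every $r\in\operatorname{Sk}(\mathbf A)$ the maximum $\pi_I(r)=\max\{p\in I:p\le r\}$ exists. The visibility partition $\mathcal P_I$ is the partition of $\operatorname{Sk}(\mathbf A)$ into the fibres of $\pi_I$. For $a\in A$ put $u_a=\pi_I(\tau(a))$. $\mathbf A$ is subsemilattice-steady over the visible subsemilattice $I$ if for all $a,b\in A$: $u_{ab}=u_au_b$, $u_{a\backslash b}=u_au_b$ and $u_{a/b}=u_au_b$.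 *)

theory Defs
  imports "HOL-Library.Disjoint_Sets"
begin

section \<open>Balanced residuated partially ordered semigroups\<close>

(* lres x y is the left residual (written with a backslash in the literature, "x under y"),
   rres x y the right residual "x over y".  The semigroup product is the usual ( * ). *)
class residuated_posemigroup = order + semigroup_mult +
  fixes lres :: "'a \<Rightarrow> 'a \<Rightarrow> 'a" (infixr "\<setminus>" 70)
    and rres :: "'a \<Rightarrow> 'a \<Rightarrow> 'a" (infixl "\<sslash>" 70)
  assumes rres_residuation: "x * y \<le> z \<longleftrightarrow> x \<le> z \<sslash> y"
    and lres_residuation: "x * y \<le> z \<longleftrightarrow> y \<le> x \<setminus> z"

definition (in residuated_posemigroup) positive :: "'a \<Rightarrow> bool" where
  "positive p \<longleftrightarrow> (\<forall>z. z \<le> z * p \<and> z \<le> p * z)"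

class balanced_residuated_posemigroup = residuated_posemigroup +
  assumes lres_self_eq_rres_self: "x \<setminus> x = x \<sslash> x"
    and positive_lres_self: "positive (x \<setminus> x)"

definition tau :: "'a::balanced_residuated_posemigroup \<Rightarrow> 'a" where
  "tau x = x \<setminus> x"

definition Sk :: "'a::balanced_residuated_posemigroup set" where
  "Sk = {p. positive p \<and> p * p = p}"

definition layer :: "'a::balanced_residuated_posemigroup set \<Rightarrow> 'a set" where
  "layer P = {x. tau x \<in> P}"


section \<open>Skeleton partitions and residual coherentization\<close>

definition tau_star ::
    "'a::balanced_residuated_posemigroup set \<Rightarrow> 'a set \<Rightarrow> 'a set" where
  "tau_star P Q =
     (\<Union>x\<in>layer P. \<Union>y\<in>layer Q. {tau (x * y), tau (x \<setminus> y), tau (x \<sslash> y)})"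

definition Out ::
    "'a::balanced_residuated_posemigroup set set \<Rightarrow> 'a set \<Rightarrow> 'a set \<Rightarrow> 'a set set" where
  "Out \<Theta> P Q = {C \<in> \<Theta>. C \<inter> tau_star P Q \<noteq> {}}"

definition residuation_coherent :: "'a::balanced_residuated_posemigroup set set \<Rightarrow> bool" where
  "residuation_coherent \<Theta> \<longleftrightarrow>
     partition_on Sk \<Theta> \<and> (\<forall>P\<in>\<Theta>. \<forall>Q\<in>\<Theta>. is_singleton (Out \<Theta> P Q))"

definition block_graph :: "'a::balanced_residuated_posemigroup set set \<Rightarrow> 'a set rel" where
  "block_graph \<Theta> =
     {(C, D). C \<noteq> D \<and> (\<exists>P\<in>\<Theta>. \<exists>Q\<in>\<Theta>. C \<in> Out \<Theta> P Q \<and> D \<in> Out \<Theta> P Q)}"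

(* The connected components of the graph are the classes in \<Theta> // (block_graph \<Theta>)\<^sup>*;
   the graph relation is symmetric and its edges stay inside \<Theta>. *)
definition CC_r ::
    "'a::balanced_residuated_posemigroup set set \<Rightarrow> 'a set set" where
  "CC_r \<Theta> = Union ` (\<Theta> // (block_graph \<Theta>)\<^sup>*)"

primrec Theta :: "nat \<Rightarrow> 'a::balanced_residuated_posemigroup set set" where
  "Theta 0 = (\<lambda>u. {u}) ` Sk"
| "Theta (Suc n) = CC_r (Theta n)"

definition same_block :: "'a set set \<Rightarrow> 'a rel" where
  "same_block \<Theta> = {(u, v). \<exists>B\<in>\<Theta>. u \<in> B \<and> v \<in> B}"

definition residual_coherentization :: "'a::balanced_residuated_posemigroup set set" where
  "residual_coherentization = Sk // (\<Union>n. same_block (Theta n))"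


section \<open>Visible subsemilattices\<close>

definition visible :: "'a::balanced_residuated_posemigroup set \<Rightarrow> bool" where
  "visible I \<longleftrightarrow>
     I \<noteq> {} \<and> I \<subseteq> Sk \<and> (\<forall>p\<in>I. \<forall>q\<in>I. p * q \<in> I) \<and>
     (\<forall>r\<in>Sk. \<exists>m\<in>I. m \<le> r \<and> (\<forall>p\<in>I. p \<le> r \<longrightarrow> p \<le> m))"

(* Only meaningful when I is visible and r is in the skeleton. *)
definition vis_proj ::
    "'a::balanced_residuated_posemigroup set \<Rightarrow> 'a \<Rightarrow> 'a" where
  "vis_proj I r = (GREATEST p. p \<in> I \<and> p \<le> r)"

definition visibility_partition ::
    "'a::balanced_residuated_posemigroup set \<Rightarrow> 'a set set" where
  "visibility_partition I = (\<lambda>q. {r \<in> Sk. vis_proj I r = vis_proj I q}) ` Sk"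

definition vis_value :: "'a::balanced_residuated_posemigroup set \<Rightarrow> 'a \<Rightarrow> 'a" where
  "vis_value I a = vis_proj I (tau a)"

definition vis_fibre ::
    "'a::balanced_residuated_posemigroup set \<Rightarrow> 'a \<Rightarrow> 'a set" where
  "vis_fibre I p = {a. vis_value I a = p}"

definition subsemilattice_steady ::
    "'a::balanced_residuated_posemigroup set \<Rightarrow> bool" where
  "subsemilattice_steady I \<longleftrightarrow>
     (\<forall>a b. vis_value I (a * b) = vis_value I a * vis_value I b \<and>
            vis_value I (a \<setminus> b) = vis_value I a * vis_value I b \<and>
            vis_value I (a \<sslash> b) = vis_value I a * vis_value I b)"

end

theory Submission
  imports Defs
begin

(* Steadiness makes the visibility value of tau (x * y), tau (x \<setminus> y) and tau (x \<sslash> y) depend only on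
   the visibility values of x and y, so each output set of the visibility partition is a single block.
   Any coherent partition \<Phi> bounds the coherentization from above: if \<Theta> refines \<Phi>, then all blocks of
   one output set of \<Theta> lie in one output block of \<Phi>, so merging along the block graph still refines \<Phi>. *)

section \<open>Partitions: blocks sharing a point, and cardinality under refinement\<close>

lemma partition_on_block_eq:
  assumes "partition_on A P" "X \<in> P" "Y \<in> P" "u \<in> X" "u \<in> Y"
  shows "X = Y"
  using assms by (auto simp: partition_on_def disjoint_def)

text \<open>Each block of \<open>Q\<close> is nonempty and covered by blocks of \<open>P\<close>, so
  it contains one of them. Choosing one for each block of \<open>Q\<close> is injective, because
  distinct blocks of \<open>Q\<close> are disjoint and the chosen ones are nonempty.\<close>

lemma card_le_if_refines:
  assumes "refines A P Q" "finite P"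
  shows "card Q \<le> card P"
proof -
  have Q: "partition_on A Q" and P: "partition_on A P"
    and PQ: "\<And>X. X \<in> P \<Longrightarrow> \<exists>Y\<in>Q. X \<subseteq> Y"
    using assms by (auto simp: refines_def)
  have "\<exists>X\<in>P. X \<subseteq> Y" if Y: "Y \<in> Q" for Y
  proof -
    obtain u where u: "u \<in> Y" using Q Y unfolding partition_on_def by (metis all_not_in_conv)
    then have "u \<in> \<Union>P" using P Q Y by (auto simp: partition_on_def)
    then obtain X where X: "X \<in> P" "u \<in> X" by blast
    with PQ[of X] obtain Z where "Z \<in> Q" "X \<subseteq> Z" by blast
    with X u Y have "Z = Y" using partition_on_block_eq[OF Q] by blast
    with X \<open>X \<subseteq> Z\<close> show ?thesis by blast
  qed
  then obtain f where f: "\<And>Y. Y \<in> Q \<Longrightarrow> f Y \<in> P \<and> f Y \<subseteq> Y" by metis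
  have "inj_on f Q"
  proof (rule inj_onI)
    fix Y Z assume YZ: "Y \<in> Q" "Z \<in> Q" "f Y = f Z"
    obtain u where "u \<in> f Y" using P f[OF YZ(1)] by (fastforce simp: partition_on_def)
    with YZ f show "Y = Z" using partition_on_block_eq[OF Q] by (metis subsetD)
  qed
  then show ?thesis using f assms(2) by (intro card_inj_on_le[of f]) auto
qed

section \<open>The map \<open>tau\<close> and the skeleton\<close>

lemma residual_self_mult_idem:
  fixes x :: "'a::balanced_residuated_posemigroup"
  shows "(x \<setminus> x) * (x \<setminus> x) \<le> x \<setminus> x"
proof -
  let ?t = "x \<setminus> x"
  have xt: "x * ?t \<le> x" by (simp add: lres_residuation)
  have "x \<le> x \<sslash> ?t" using xt by (simp add: rres_residuation)
  \<comment> \<open>Passing through \<open>x \<sslash> ?t\<close> does the work of monotonicity of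
    the product in its left factor: \<open>x * ?t \<le> x\<close> can then be multiplied by
    \<open>?t\<close> once more.\<close>
  then have "x * ?t \<le> x \<sslash> ?t" using xt by (rule order_trans[rotated])
  then have "x * ?t * ?t \<le> x" by (simp add: rres_residuation)
  then show ?thesis by (simp add: mult.assoc lres_residuation)
qed

text \<open>Positivity gives \<open>t \<le> t * t\<close> for \<open>t = tau x\<close>, the converse
  of the inequality just shown.\<close>

lemma tau_in_Sk: "tau x \<in> Sk"
  using positive_lres_self[of x] residual_self_mult_idem[of x]
  by (auto simp: tau_def Sk_def positive_def intro: antisym)

text \<open>Positivity of \<open>p\<close> gives one inequality and idempotence the other. Hence a
  set of skeleton elements is contained in its own layer, so layers of blocks are inhabited.\<close>

lemma tau_Sk:
  assumes "p \<in> Sk"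
  shows "tau p = p"
proof (rule antisym)
  have "p \<setminus> p \<le> p * (p \<setminus> p)" using assms by (auto simp: Sk_def positive_def)
  also have "\<dots> \<le> p" by (simp add: lres_residuation)
  finally show "tau p \<le> p" by (simp add: tau_def)
  show "p \<le> tau p" using assms by (simp add: tau_def Sk_def flip: lres_residuation)
qed

section \<open>Projection onto a visible subsemilattice and its fibres\<close>

lemma vis_proj_props:
  assumes "visible I" "r \<in> Sk"
  shows "vis_proj I r \<in> I" "vis_proj I r \<le> r" "p \<in> I \<Longrightarrow> p \<le> r \<Longrightarrow> p \<le> vis_proj I r"
proof -
  obtain m where m: "m \<in> I" "m \<le> r" "\<And>p. p \<in> I \<Longrightarrow> p \<le> r \<Longrightarrow> p \<le> m"
    using assms unfolding visible_def by meson
  \<comment> \<open>\<open>GREATEST\<close> has a meaningful value only if a maximum exists;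
    visibility provides it as \<open>m\<close>.\<close>
  have "vis_proj I r = m" unfolding vis_proj_def by (rule Greatest_equality) (use m in auto)
  with m show "vis_proj I r \<in> I" "vis_proj I r \<le> r" "p \<in> I \<Longrightarrow> p \<le> r \<Longrightarrow> p \<le> vis_proj I r"
    by auto
qed

lemma vis_proj_idem:
  assumes "visible I" "p \<in> I"
  shows "vis_proj I p = p"
  using assms vis_proj_props[of I p] by (auto simp: visible_def intro!: antisym)

lemma partition_on_visibility_partition: "partition_on Sk (visibility_partition I)"
  by (auto simp: partition_on_def visibility_partition_def disjoint_def)

text \<open>The projection fixes \<open>I\<close> pointwise, so its image is exactly
  \<open>I\<close>, and sending \<open>p\<close> to the fibre over \<open>p\<close> is a bijection
  from \<open>I\<close> onto the blocks.\<close>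

lemma card_visibility_partition:
  assumes "visible I"
  shows "card (visibility_partition I) = card I"
proof -
  have I: "I \<subseteq> Sk" using assms by (simp add: visible_def)
  have "vis_proj I ` Sk = I"
  proof
    show "vis_proj I ` Sk \<subseteq> I" using vis_proj_props(1)[OF assms] by blast
    show "I \<subseteq> vis_proj I ` Sk"
    proof
      fix p assume "p \<in> I"
      with I vis_proj_idem[OF assms] show "p \<in> vis_proj I ` Sk" by (metis image_eqI subsetD)
    qed
  qed
  moreover have "visibility_partition I = (\<lambda>p. {r \<in> Sk. vis_proj I r = p}) ` vis_proj I ` Sk"
    by (simp add: visibility_partition_def image_image)
  moreover have "inj_on (\<lambda>p. {r \<in> Sk. vis_proj I r = p}) I"
  proof (rule inj_onI)
    fix p q assume pq: "p \<in> I" "q \<in> I" "{r \<in> Sk. vis_proj I r = p} = {r \<in> Sk. vis_proj I r = q}"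
    then have "p \<in> {r \<in> Sk. vis_proj I r = p}" using I vis_proj_idem[OF assms] by auto
    then have "vis_proj I p = q" using pq(3) by simp
    with pq(1) show "p = q" using vis_proj_idem[OF assms] by simp
  qed
  ultimately show ?thesis by (simp add: card_image)
qed

section \<open>Coherence of the visibility partition\<close>

lemma Out_nonempty:
  assumes "partition_on Sk \<Theta>" "P \<in> \<Theta>" "Q \<in> \<Theta>"
  shows "Out \<Theta> P Q \<noteq> {}"
proof -
  have "P \<noteq> {}" "Q \<noteq> {}" "P \<subseteq> Sk" "Q \<subseteq> Sk"
    using assms by (auto simp: partition_on_def)
  then obtain x y where xy: "x \<in> P" "y \<in> Q" "x \<in> Sk" "y \<in> Sk" by blast
  \<comment> \<open>Skeleton elements are their own \<open>tau\<close>, so \<open>x\<close> and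
    \<open>y\<close> lie in the layers of their blocks.\<close>
  then have "tau (x * y) \<in> tau_star P Q"
    unfolding tau_star_def layer_def by (intro UN_I[of x] UN_I[of y]) (auto simp: tau_Sk)
  moreover obtain C where "C \<in> \<Theta>" "tau (x * y) \<in> C"
    using assms(1) tau_in_Sk unfolding partition_on_def by blast
  ultimately show ?thesis by (auto simp: Out_def)
qed

lemma residuation_coherent_visibility_partition:
  assumes "subsemilattice_steady I"
  shows "residuation_coherent (visibility_partition I)"
  unfolding residuation_coherent_def
proof (intro conjI ballI)
  show part: "partition_on Sk (visibility_partition I)"
    by (rule partition_on_visibility_partition)
  fix P Q assume PQ: "P \<in> visibility_partition I" "Q \<in> visibility_partition I"
  then obtain p q where
    P: "P = {r \<in> Sk. vis_proj I r = p}" and Q: "Q = {r \<in> Sk. vis_proj I r = q}"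
    by (auto simp: visibility_partition_def)
  have "vis_proj I w = p * q" if "w \<in> tau_star P Q" for w
    using that assms unfolding tau_star_def layer_def P Q subsemilattice_steady_def vis_value_def
    by auto
  \<comment> \<open>A block is a full fibre of the projection, so meeting
    \<open>tau_star P Q\<close> in one point already forces it to be the fibre over
    \<open>p * q\<close>.\<close>
  then have "C = {r \<in> Sk. vis_proj I r = p * q}" if "C \<in> Out (visibility_partition I) P Q" for C
    using that by (auto simp: Out_def visibility_partition_def)
  with Out_nonempty[OF part PQ] show "is_singleton (Out (visibility_partition I) P Q)"
    unfolding is_singleton_def by blast
qed

section \<open>Connected components of the block graph\<close>

lemma equiv_block_graph_rtrancl: "equiv UNIV ((block_graph \<Theta>)\<^sup>*)"
proof (rule equivI)
  have "sym (block_graph \<Theta>)" by (auto simp: sym_def block_graph_def)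
  then show "sym ((block_graph \<Theta>)\<^sup>*)" by (rule sym_rtrancl)
qed (auto simp: refl_rtrancl trans_rtrancl)

text \<open>The reflexive closure also relates sets outside \<open>\<Theta>\<close> to themselves,
  so the start of the path has to be a block.\<close>

lemma block_graph_rtrancl_closed:
  assumes "(C, D) \<in> (block_graph \<Theta>)\<^sup>*" "C \<in> \<Theta>"
  shows "D \<in> \<Theta>"
  using assms by (induction rule: rtrancl_induct) (auto simp: block_graph_def Out_def)

lemma partition_on_CC_r:
  fixes \<Theta> :: "'a::balanced_residuated_posemigroup set set"
  assumes "partition_on Sk \<Theta>"
  shows "partition_on Sk (CC_r \<Theta>)"
proof (rule partition_onI)
  let ?R = "(block_graph \<Theta>)\<^sup>*"
  show "\<Union>(CC_r \<Theta>) = Sk"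
    using assms block_graph_rtrancl_closed[of _ _ \<Theta>]
    unfolding partition_on_def CC_r_def quotient_def by blast
  show "{} \<notin> CC_r \<Theta>"
  proof
    assume "{} \<in> CC_r \<Theta>"
    then obtain C where C: "C \<in> \<Theta>" "{} = \<Union>(?R `` {C})" by (auto simp: CC_r_def quotient_def)
    moreover have "C \<in> ?R `` {C}" by simp
    ultimately have "C = {}" by blast
    with C assms show False by (simp add: partition_on_def)
  qed
  fix X Y assume XY: "X \<in> CC_r \<Theta>" "Y \<in> CC_r \<Theta>" "X \<noteq> Y"
  obtain C D where CD: "C \<in> \<Theta>" "D \<in> \<Theta>" "X = \<Union>(?R `` {C})" "Y = \<Union>(?R `` {D})"
    using XY by (auto simp: CC_r_def quotient_def)
  show "disjnt X Y"
  proof (rule ccontr)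
    assume "\<not> disjnt X Y"
    then obtain u C' D' where u: "(C, C') \<in> ?R" "(D, D') \<in> ?R" "u \<in> C'" "u \<in> D'"
      using CD by (auto simp: disjnt_def)
    \<comment> \<open>Both are blocks of \<open>\<Theta>\<close> containing \<open>u\<close>; a
      common block then makes the two components coincide.\<close>
    then have "C' = D'"
      using partition_on_block_eq[OF assms] block_graph_rtrancl_closed CD by metis
    with u have "?R `` {C} = ?R `` {D}"
      using equiv_block_graph_rtrancl[of \<Theta>] by (metis equiv_class_eq)
    with CD XY show False by simp
  qed
qed

lemma refines_CC_r:
  assumes "partition_on Sk \<Theta>"
  shows "refines Sk \<Theta> (CC_r \<Theta>)"
  unfolding refines_def
proof (intro conjI ballI assms partition_on_CC_r)
  fix C assume "C \<in> \<Theta>"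
  then have "\<Union>((block_graph \<Theta>)\<^sup>* `` {C}) \<in> CC_r \<Theta>" by (auto simp: CC_r_def quotient_def)
  moreover have "C \<subseteq> \<Union>((block_graph \<Theta>)\<^sup>* `` {C})" by auto
  ultimately show "\<exists>D\<in>CC_r \<Theta>. C \<subseteq> D" by blast
qed

lemma tau_star_mono: "P \<subseteq> P' \<Longrightarrow> Q \<subseteq> Q' \<Longrightarrow> tau_star P Q \<subseteq> tau_star P' Q'"
  unfolding tau_star_def layer_def by blast

lemma CC_r_refines_coherent:
  assumes "refines Sk \<Theta> \<Phi>" "residuation_coherent \<Phi>"
  shows "refines Sk (CC_r \<Theta>) \<Phi>"
proof -
  have \<Theta>: "partition_on Sk \<Theta>" and \<Phi>: "partition_on Sk \<Phi>"
    and sub: "\<And>X. X \<in> \<Theta> \<Longrightarrow> \<exists>Y\<in>\<Phi>. X \<subseteq> Y"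
    using assms(1) by (auto simp: refines_def)
  have edge: "D \<subseteq> Y" if CD: "(C, D) \<in> block_graph \<Theta>" and Y: "Y \<in> \<Phi>" "C \<subseteq> Y" for C D Y
  proof -
    obtain P Q where PQ: "P \<in> \<Theta>" "Q \<in> \<Theta>" "C \<in> Out \<Theta> P Q" "D \<in> Out \<Theta> P Q"
      using CD unfolding block_graph_def by blast
    obtain P' Q' where PQ': "P' \<in> \<Phi>" "Q' \<in> \<Phi>" "P \<subseteq> P'" "Q \<subseteq> Q'" using sub PQ by meson
    obtain Z where Z: "Z \<in> \<Phi>" "D \<subseteq> Z" using sub PQ by (auto simp: Out_def)
    have "tau_star P Q \<subseteq> tau_star P' Q'" using PQ' by (intro tau_star_mono)
    \<comment> \<open>\<open>C\<close> and \<open>D\<close> meet \<open>tau_star P Q\<close>, hence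
      the larger sets \<open>Y\<close> and \<open>Z\<close> meet the larger set
      \<open>tau_star P' Q'\<close>.\<close>
    then have "Y \<in> Out \<Phi> P' Q'" "Z \<in> Out \<Phi> P' Q'" using PQ Y Z by (auto simp: Out_def)
    moreover have "is_singleton (Out \<Phi> P' Q')"
      using assms(2) PQ' by (auto simp: residuation_coherent_def)
    ultimately have "Y = Z" by (auto simp: is_singleton_def)
    with Z show ?thesis by simp
  qed
  have path: "D \<subseteq> Y" if "(C, D) \<in> (block_graph \<Theta>)\<^sup>*" "Y \<in> \<Phi>" "C \<subseteq> Y" for C D Y
    using that by (induction rule: rtrancl_induct) (auto dest: edge)
  have "\<exists>Y\<in>\<Phi>. X \<subseteq> Y" if X: "X \<in> CC_r \<Theta>" for X
  proof -
    obtain C where C: "C \<in> \<Theta>" "X = \<Union>((block_graph \<Theta>)\<^sup>* `` {C})"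
      using X by (auto simp: CC_r_def quotient_def)
    then obtain Y where "Y \<in> \<Phi>" "C \<subseteq> Y" using sub by blast
    with C path show ?thesis by (intro bexI[of _ Y]) auto
  qed
  then show ?thesis using partition_on_CC_r[OF \<Theta>] \<Phi> by (simp add: refines_def)
qed

section \<open>The iteration and its limit\<close>

lemma partition_on_Theta: "partition_on Sk (Theta n)"
  by (induction n) (simp_all add: partition_on_singletons partition_on_CC_r)

lemma Theta_refines_coherent:
  assumes "residuation_coherent \<Phi>"
  shows "refines Sk (Theta n) \<Phi>"
proof (induction n)
  case 0
  show ?case
    using partition_on_Theta[of 0] assms
    by (auto simp: refines_def residuation_coherent_def partition_on_def)
qed (simp add: CC_r_refines_coherent assms)

lemma same_block_mono:
  assumes "refines A P Q"
  shows "same_block P \<subseteq> same_block Q"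
  using assms unfolding refines_def same_block_def by blast

lemma equiv_same_block:
  assumes "partition_on A P"
  shows "equiv A (same_block P)"
  using equiv_partition_on[OF assms] by (simp add: same_block_def)

text \<open>Only transitivity uses the chain condition: two pairs from stages \<open>m\<close> and
  \<open>n\<close> both occur at stage \<open>max m n\<close>, where they can be composed.\<close>

lemma equiv_UN_chain:
  fixes r :: "nat \<Rightarrow> 'a rel"
  assumes "\<And>n. equiv A (r n)" "\<And>n. r n \<subseteq> r (Suc n)"
  shows "equiv A (\<Union>n. r n)"
proof (rule equivI)
  have mono: "m \<le> n \<Longrightarrow> r m \<subseteq> r n" for m n by (rule lift_Suc_mono_le[of r, OF assms(2)])
  show "(\<Union>n. r n) \<subseteq> A \<times> A" using assms(1) by (auto elim!: equivE)
  show "refl_on A (\<Union>n. r n)" "sym (\<Union>n. r n)"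
    using assms(1) by (auto simp: equiv_def refl_on_def sym_def)
  show "trans (\<Union>n. r n)"
  proof (rule transI)
    fix x y z assume "(x, y) \<in> (\<Union>n. r n)" "(y, z) \<in> (\<Union>n. r n)"
    then obtain m n where "(x, y) \<in> r m" "(y, z) \<in> r n" by blast
    then have "(x, y) \<in> r (max m n)" "(y, z) \<in> r (max m n)"
      using mono[of m "max m n"] mono[of n "max m n"] by auto
    then have "(x, z) \<in> r (max m n)" using assms(1) by (meson equivE transE)
    then show "(x, z) \<in> (\<Union>n. r n)" by blast
  qed
qed

lemma equiv_UN_same_block_Theta: "equiv Sk (\<Union>n. same_block (Theta n))"
  using equiv_same_block[OF partition_on_Theta] same_block_mono[OF refines_CC_r[OF partition_on_Theta]]
  by (intro equiv_UN_chain) auto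

text \<open>Every stage refines \<open>\<Phi>\<close>, so the union of the stage equivalences is
  contained in that of \<open>\<Phi>\<close>, and the class of \<open>u\<close> stays inside the
  block of \<open>\<Phi>\<close> around \<open>u\<close>.\<close>

lemma residual_coherentization_refines_coherent:
  assumes "residuation_coherent \<Phi>"
  shows "refines Sk residual_coherentization \<Phi>"
  unfolding refines_def
proof (intro conjI ballI)
  show "partition_on Sk residual_coherentization"
    unfolding residual_coherentization_def
    using equiv_UN_same_block_Theta by (rule partition_on_quotient)
  show \<Phi>: "partition_on Sk \<Phi>" using assms by (simp add: residuation_coherent_def)
  fix X assume "X \<in> (residual_coherentization :: 'a set set)"
  then obtain u where u: "u \<in> Sk" "X = (\<Union>n. same_block (Theta n)) `` {u}"
    by (auto simp: residual_coherentization_def quotient_def)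
  then obtain Y where Y: "Y \<in> \<Phi>" "u \<in> Y" using \<Phi> by (auto simp: partition_on_def)
  have "v \<in> Y" if "v \<in> X" for v
  proof -
    have "(u, v) \<in> same_block \<Phi>"
      using that u same_block_mono[OF Theta_refines_coherent[OF assms]] by blast
    with Y show ?thesis using partition_on_block_eq[OF \<Phi>] by (auto simp: same_block_def)
  qed
  with Y show "\<exists>Y\<in>\<Phi>. X \<subseteq> Y" by blast
qed

theorem theorem8p3:
  fixes I :: "'a::balanced_residuated_posemigroup set"
  assumes "visible I"
    and "subsemilattice_steady I"
  shows "residuation_coherent (visibility_partition I)
    \<and> refines Sk residual_coherentization (visibility_partition I)
    \<and> (\<forall>C\<in>residual_coherentization. \<exists>p\<in>I. layer C \<subseteq> vis_fibre I p)
    \<and> (finite (Sk :: 'a set) \<longrightarrow>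
         card (visibility_partition I) \<le> card (residual_coherentization :: 'a set set)
         \<and> card (visibility_partition I) = card I)"
proof (intro conjI ballI impI)
  show coh: "residuation_coherent (visibility_partition I)"
    using assms(2) by (rule residuation_coherent_visibility_partition)
  show ref: "refines Sk residual_coherentization (visibility_partition I)"
    using coh by (rule residual_coherentization_refines_coherent)
  show "\<exists>p\<in>I. layer C \<subseteq> vis_fibre I p" if C: "C \<in> residual_coherentization" for C
  proof -
    obtain q where "q \<in> Sk" "C \<subseteq> {r \<in> Sk. vis_proj I r = vis_proj I q}"
      using ref C unfolding refines_def visibility_partition_def by blast
    \<comment> \<open>The index of the fibre is the common projection value on the visibility block
      containing \<open>C\<close>.\<close>
    then show ?thesis using vis_proj_props(1)[OF assms(1)]
      by (intro bexI[of _ "vis_proj I q"]) (auto simp: layer_def vis_fibre_def vis_value_def)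
  qed
  show "card (visibility_partition I) = card I"
    using assms(1) by (rule card_visibility_partition)
  assume "finite (Sk :: 'a set)"
  \<comment> \<open>An infinite set has \<open>card\<close> 0, so the inequality needs the finer
    partition to be finite.\<close>
  then have "finite (residual_coherentization :: 'a set set)"
    using ref by (auto simp: refines_def intro: finite_elements)
  with ref show "card (visibility_partition I) \<le> card (residual_coherentization :: 'a set set)"
    by (rule card_le_if_refines)
qed

end
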